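(* If $W$ is a finite irreducible Coxeter group with degrees $d_1,\dots,d_n$ and Coxeter number $h$, then $$\operatorname{Cat}\{W\}=\prod_{i=1}^{n}\frac{\{h+d_i\}}{\{d_i\}}$$ is in $\mathbb{N}[s,t]$.
   Context: Let $s,t$ be indeterminates and $\mathbb{N}=\{0,1,2,\dots\}$. The Lucas sequence is $\{0\}=0$, $\{1\}=1$, $\{n\}=s\{n-1\}+t\{n-2\}$ for $n\ge 2$. The degrees $d_1,\dots,d_n$ and Coxeter number $h$ (the largest degree) of the finite irreducible Coxeter groups are: $A_n$: degrees $2,3,4,\dots,n+1$; $h=n+1$. $B_n$: degrees $2,4,6,\dots,2n$; $h=2n$. $D_n$ ($n\ge 3$): degrees $2,4,6,\dots,2(n-1),n$; $h=2(n-1)$. $I_2(m)$ ($m\ge 2$): degrees $2,m$; $h=m$. $H_3$: degrees $2,6,10$; $h=10$. $H_4$: degrees $2,12,20,30$; $h=30$. $F_4$: degrees $2,6,8,12$; $h=12$. $E_6$: degrees $2,5,6,8,9,12$; $h=12$. $E_7$: degrees $2,6,8,10,12,14,18$; $h=18$. $E_8$: degrees $2,8,12,14,18,20,24,30$; $h=30$. *)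

theory Defs
  imports
    "HOL-Computational_Algebra.Polynomial"
    "HOL-Computational_Algebra.Polynomial_Factorial"
begin

(* The ring Z[s,t] is rendered as int poly poly (polynomials in s whose coefficients are
   polynomials in t), and its field of fractions as int poly poly fract. *)

definition var_s :: "int poly poly" where
  "var_s = [:0, 1:]"

definition var_t :: "int poly poly" where
  "var_t = [:[:0, 1:]:]"

fun lucas :: "nat \<Rightarrow> int poly poly" where
  "lucas 0 = 0"
| "lucas (Suc 0) = 1"
| "lucas (Suc (Suc n)) = var_s * lucas (Suc n) + var_t * lucas n"

(* The subset N[s,t] of Z[s,t]: coeff (coeff p i) j is the coefficient of s^i t^j. *)
definition nat_polys :: "int poly poly set" where
  "nat_polys = {p. \<forall>i j. coeff (coeff p i) j \<in> \<nat>}"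

(* Finite irreducible Coxeter groups, given by their type in the classification. *)
datatype coxeter =
    Cox_A nat | Cox_B nat | Cox_D nat | Cox_I2 nat
  | Cox_H3 | Cox_H4 | Cox_F4 | Cox_E6 | Cox_E7 | Cox_E8

(* The admissible parameters of the infinite families; small parameters give coincidences
   such as B_1 = A_1 and D_3 = A_3, and I_2(2) (in fact A_1 x A_1) is included by convention. *)
fun coxeter_type :: "coxeter \<Rightarrow> bool" where
  "coxeter_type (Cox_A n) \<longleftrightarrow> n \<ge> 1"
| "coxeter_type (Cox_B n) \<longleftrightarrow> n \<ge> 1"
| "coxeter_type (Cox_D n) \<longleftrightarrow> n \<ge> 3"
| "coxeter_type (Cox_I2 m) \<longleftrightarrow> m \<ge> 2"
| "coxeter_type _ \<longleftrightarrow> True"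

(* A list rather than a set, since degrees can repeat: D_n with n even has the degree n twice. *)
fun degrees :: "coxeter \<Rightarrow> nat list" where
  "degrees (Cox_A n) = map (\<lambda>i. i + 1) [1..<n + 1]"
| "degrees (Cox_B n) = map (\<lambda>i. 2 * i) [1..<n + 1]"
| "degrees (Cox_D n) = map (\<lambda>i. 2 * i) [1..<n] @ [n]"
| "degrees (Cox_I2 m) = [2, m]"
| "degrees Cox_H3 = [2, 6, 10]"
| "degrees Cox_H4 = [2, 12, 20, 30]"
| "degrees Cox_F4 = [2, 6, 8, 12]"
| "degrees Cox_E6 = [2, 5, 6, 8, 9, 12]"
| "degrees Cox_E7 = [2, 6, 8, 10, 12, 14, 18]"
| "degrees Cox_E8 = [2, 8, 12, 14, 18, 20, 24, 30]"

fun coxeter_number :: "coxeter \<Rightarrow> nat" where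
  "coxeter_number (Cox_A n) = n + 1"
| "coxeter_number (Cox_B n) = 2 * n"
| "coxeter_number (Cox_D n) = 2 * (n - 1)"
| "coxeter_number (Cox_I2 m) = m"
| "coxeter_number Cox_H3 = 10"
| "coxeter_number Cox_H4 = 30"
| "coxeter_number Cox_F4 = 12"
| "coxeter_number Cox_E6 = 12"
| "coxeter_number Cox_E7 = 18"
| "coxeter_number Cox_E8 = 30"

definition coxeter_cat :: "coxeter \<Rightarrow> int poly poly fract" where
  "coxeter_cat W =
     (\<Prod>i<length (degrees W).
        to_fract (lucas (coxeter_number W + degrees W ! i)) / to_fract (lucas (degrees W ! i)))"

lemma coxeter_number_eq_Max_degrees:
  assumes "coxeter_type W"
  shows "coxeter_number W = Max (set (degrees W))"
proof -
  have "\<forall>d\<in>set (degrees W). d \<le> coxeter_number W"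
    using assms by (cases W) auto
  moreover have "coxeter_number W \<in> set (degrees W)"
    using assms by (cases W) auto
  ultimately show ?thesis
    by (intro Max_eqI[symmetric]) auto
qed

(* No denominator of coxeter_cat vanishes (recall that x / 0 = 0). *)
lemma lucas_nonzero:
  assumes "n \<ge> 1"
  shows "lucas n \<noteq> 0"
proof -
  have "poly (poly (lucas n) 1) 1 \<ge> 0 \<and> (n \<ge> 1 \<longrightarrow> poly (poly (lucas n) 1) 1 \<ge> 1)"
    by (induction n rule: lucas.induct) (auto simp: var_s_def var_t_def)
  then show ?thesis
    using assms by auto
qed

lemma degrees_pos:
  assumes "coxeter_type W" "d \<in> set (degrees W)"
  shows "d \<ge> 1"
  using assms by (cases W) auto

end

theory Submission
  imports Defs
begin

text \<open>Over the reals the Lucas polynomial \<open>{n}\<close> factors into pieces with nonnegative coefficients.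
  In terms of roots \<open>x, y\<close> with \<open>s = x + y\<close>, \<open>t = -x y\<close> it is \<open>(x^n - y^n) / (x - y)\<close>, the product
  of \<open>x - \<zeta> y\<close> over the nontrivial \<open>n\<close>-th roots of unity \<open>\<zeta>\<close>. The factors of \<open>\<zeta> = exp (2 \<pi> i r)\<close>
  and its conjugate multiply to \<open>s\<^sup>2 + 4 cos\<^sup>2 (\<pi> r) t\<close>, and \<open>\<zeta> = -1\<close> contributes \<open>s\<close>. So \<open>{n}\<close> is the
  product of one such factor for each \<open>r = k / n\<close> with \<open>0 < r \<le> 1/2\<close> (\<open>lucas_factorization\<close>). Here
  this is proved by specializing \<open>t\<close> to \<open>-y\<^sup>2\<close>, which yields Chebyshev polynomials with known roots.

  If \<open>r\<close> has denominator \<open>m\<close> in lowest terms, then its factor occurs in \<open>{n}\<close> exactly when \<open>m\<close>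
  divides \<open>n\<close>. A quotient of products of Lucas polynomials is therefore a product of such factors
  as soon as every \<open>m \<ge> 2\<close> divides at least as many indices in the numerator as in the
  denominator. Nonnegativity of its coefficients is then evident, and they are integers because the
  denominator is monic in \<open>s\<close> (\<open>lucas_quotient_nat_polys\<close>).

  What remains is arithmetic of the degrees (\<open>degree_multiples_le\<close>): each \<open>m \<ge> 2\<close> divides at least as
  many of the numbers \<open>h + d\<^sub>i\<close> as of the numbers \<open>d\<^sub>i\<close>. For types \<open>A\<close>, \<open>B\<close>, \<open>D\<close> this
  reduces to \<open>\<lfloor>a/m\<rfloor> + \<lfloor>b/m\<rfloor> \<le> \<lfloor>(a + b)/m\<rfloor>\<close> and a gain of one when \<open>m\<close> divides \<open>a + 1\<close> for
  \<open>a = b\<close>; type \<open>I\<^sub>2\<close> is immediate, and the other types are finitely many cases.\<close>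

section \<open>Bivariate polynomials with real coefficients\<close>

lemma map_poly_add_hom:
  fixes h :: "'a::comm_ring_1 \<Rightarrow> 'b::comm_ring_1"
  assumes "h 0 = 0" "\<And>x y. h (x + y) = h x + h y"
  shows "map_poly h (p + q) = map_poly h p + map_poly h q"
  by (rule poly_eqI) (simp add: coeff_map_poly assms)

lemma map_poly_mult_hom:
  fixes h :: "'a::comm_ring_1 \<Rightarrow> 'b::comm_ring_1"
  assumes "h 0 = 0" "\<And>x y. h (x + y) = h x + h y" "\<And>x y. h (x * y) = h x * h y"
  shows "map_poly h (p * q) = map_poly h p * map_poly h q"
proof (rule poly_eqI)
  fix n
  have sum: "h (sum f A) = (\<Sum>x\<in>A. h (f x))" for f :: "nat \<Rightarrow> 'a" and A
    by (induction A rule: infinite_finite_induct) (simp_all add: assms)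
  show "coeff (map_poly h (p * q)) n = coeff (map_poly h p * map_poly h q) n"
    by (simp add: coeff_map_poly assms coeff_mult sum)
qed

definition real_coeffs :: "int poly poly \<Rightarrow> real poly poly" where
  "real_coeffs = map_poly (map_poly real_of_int)"

lemma coeff_real_coeffs: "coeff (coeff (real_coeffs p) i) j = real_of_int (coeff (coeff p i) j)"
  by (simp add: real_coeffs_def coeff_map_poly)

lemma real_coeffs_0 [simp]: "real_coeffs 0 = 0"
  by (simp add: real_coeffs_def)

lemma real_coeffs_1 [simp]: "real_coeffs 1 = 1"
  by (simp add: real_coeffs_def)

lemma real_coeffs_add: "real_coeffs (p + q) = real_coeffs p + real_coeffs q"
  unfolding real_coeffs_def by (intro map_poly_add_hom) (simp_all add: map_poly_add_hom)

lemma real_coeffs_mult: "real_coeffs (p * q) = real_coeffs p * real_coeffs q"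
  unfolding real_coeffs_def
  by (intro map_poly_mult_hom) (simp_all add: map_poly_add_hom map_poly_mult_hom)

lemma real_coeffs_eq_iff: "real_coeffs p = real_coeffs q \<longleftrightarrow> p = q"
proof
  assume "real_coeffs p = real_coeffs q"
  then have "coeff (coeff p i) j = coeff (coeff q i) j" for i j
    using coeff_real_coeffs[of p i j] coeff_real_coeffs[of q i j] by simp
  then show "p = q"
    by (intro poly_eqI)
qed simp

lemma degree_real_coeffs: "degree (real_coeffs p) = degree p"
  unfolding real_coeffs_def
  by (rule degree_map_poly) (simp add: map_poly_eq_0_iff)

text \<open>Long division by a polynomial that is monic in \<open>s\<close> introduces no denominators, and its result
  is the same over \<open>\<int>[t]\<close> and over \<open>\<real>[t]\<close>.\<close>

lemma real_quotient_is_integral: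
  assumes monic: "lead_coeff B = 1" and eq: "real_coeffs A = real_coeffs B * G"
  obtains Q where "A = B * Q" "real_coeffs Q = G"
proof -
  have B0: "B \<noteq> 0"
    using monic by auto
  obtain q r where qr: "pseudo_divmod A B = (q, r)"
    by force
  have A: "A = B * q + r" and r: "r = 0 \<or> degree r < degree B"
    using pseudo_divmod[OF B0 qr] monic by auto
  have r_eq: "real_coeffs r = real_coeffs B * (G - real_coeffs q)"
    using eq unfolding A real_coeffs_add real_coeffs_mult by (simp add: algebra_simps)
  have "G - real_coeffs q = 0"
  proof (rule ccontr)
    assume *: "G - real_coeffs q \<noteq> 0"
    have "real_coeffs B \<noteq> 0"
      using B0 real_coeffs_eq_iff[of B 0] by simp
    then have "real_coeffs r \<noteq> 0" "degree (real_coeffs r) \<ge> degree B"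
      using * by (simp_all add: r_eq degree_mult_eq degree_real_coeffs)
    then show False
      using r by (auto simp: degree_real_coeffs)
  qed
  then have "r = 0" "real_coeffs q = G"
    using r_eq real_coeffs_eq_iff[of r 0] by auto
  then show ?thesis
    using A by (intro that[of q]) simp_all
qed

definition nonneg_coeffs :: "real poly poly \<Rightarrow> bool" where
  "nonneg_coeffs p \<longleftrightarrow> (\<forall>i j. coeff (coeff p i) j \<ge> 0)"

lemma nonneg_coeffs_1 [simp]: "nonneg_coeffs 1"
  by (simp add: nonneg_coeffs_def)

lemma nonneg_coeffs_mult:
  assumes "nonneg_coeffs p" "nonneg_coeffs q"
  shows "nonneg_coeffs (p * q)"
  using assms unfolding nonneg_coeffs_def
  by (auto simp: coeff_mult coeff_sum intro!: sum_nonneg)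

lemma nonneg_coeffs_power: "nonneg_coeffs p \<Longrightarrow> nonneg_coeffs (p ^ n)"
  by (induction n) (simp_all add: nonneg_coeffs_mult)

lemma nonneg_coeffs_prod: "(\<And>x. x \<in> A \<Longrightarrow> nonneg_coeffs (f x)) \<Longrightarrow> nonneg_coeffs (prod f A)"
  by (induction A rule: infinite_finite_induct) (simp_all add: nonneg_coeffs_mult)

text \<open>Specialization of \<open>t\<close>. Identities in \<open>\<real>[s,t]\<close> are proved at negative values of \<open>t\<close>, where the
  Lucas polynomials have only real roots in \<open>s\<close>.\<close>

definition set_t :: "real \<Rightarrow> real poly poly \<Rightarrow> real poly" where
  "set_t c = map_poly (\<lambda>p. poly p c)"

lemma coeff_set_t: "coeff (set_t c p) i = poly (coeff p i) c"
  by (simp add: set_t_def coeff_map_poly)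

lemma set_t_add: "set_t c (p + q) = set_t c p + set_t c q"
  unfolding set_t_def by (intro map_poly_add_hom) simp_all

lemma set_t_mult: "set_t c (p * q) = set_t c p * set_t c q"
  unfolding set_t_def by (intro map_poly_mult_hom) simp_all

lemma set_t_1 [simp]: "set_t c 1 = 1"
  by (simp add: set_t_def)

lemma set_t_prod: "set_t c (prod f A) = (\<Prod>x\<in>A. set_t c (f x))"
  by (induction A rule: infinite_finite_induct) (simp_all add: set_t_mult)

text \<open>Each coefficient of a power of \<open>s\<close> is a polynomial in \<open>t\<close>, hence determined by its values on the
  infinite set of negative reals.\<close>

lemma eq_if_set_t_eq:
  assumes "\<And>y. y > 0 \<Longrightarrow> set_t (- (y\<^sup>2)) p = set_t (- (y\<^sup>2)) q"
  shows "p = q"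
proof (rule poly_eqI, rule ccontr)
  fix i
  assume "coeff p i \<noteq> coeff q i"
  then have "finite {x. poly (coeff p i - coeff q i) x = 0}"
    by (intro poly_roots_finite) simp
  moreover have "x \<in> {x. poly (coeff p i - coeff q i) x = 0}" if "x < 0" for x
  proof -
    have "set_t x p = set_t x q"
      using assms[of "sqrt (- x)"] that by simp
    then show ?thesis
      by (simp flip: coeff_set_t)
  qed
  ultimately have "finite {..<0::real}"
    by (meson finite_subset lessThan_iff subsetI)
  then show False
    by (simp add: infinite_Iio)
qed

section \<open>Factorization of the Lucas polynomials over the reals\<close>

lemma var_s_mult: "var_s * p = pCons 0 p"
  by (simp add: var_s_def)

lemma var_t_mult: "var_t * p = smult [:0, 1:] p"
  by (simp add: var_t_def)

lemma lucas_monic_aux: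
  "coeff (lucas (Suc n)) n = 1 \<and> (\<forall>k>n. coeff (lucas (Suc n)) k = 0)"
proof (induction n rule: less_induct)
  case (less n)
  consider "n = 0" | "n = 1" | m where "n = Suc (Suc m)"
    by (metis One_nat_def not0_implies_Suc)
  then show ?case
  proof cases
    case 3
    then show ?thesis
      using less[of m] less[of "Suc m"]
      by (auto simp: var_s_mult var_t_mult coeff_pCons split: nat.splits)
  qed (auto simp: var_s_def coeff_pCons split: nat.splits)
qed

lemma degree_lucas: "degree (lucas n) = n - 1"
proof (cases n)
  case (Suc m)
  then show ?thesis
    using lucas_monic_aux[of m]
    by (intro antisym degree_le le_degree) auto
qed simp

lemma lead_coeff_lucas:
  assumes "n \<ge> 1"
  shows "lead_coeff (lucas n) = 1"
  using lucas_monic_aux[of "n - 1"] assms by (simp add: degree_lucas)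

definition lucas_at :: "real \<Rightarrow> nat \<Rightarrow> real poly" where
  "lucas_at c n = set_t c (real_coeffs (lucas n))"

lemma lucas_at_simps:
  "lucas_at c 0 = 0"
  "lucas_at c (Suc 0) = 1"
  "lucas_at c (Suc (Suc n)) = [:0, 1:] * lucas_at c (Suc n) + [:c:] * lucas_at c n"
proof -
  have "set_t c (real_coeffs var_s) = [:0, 1:]" "set_t c (real_coeffs var_t) = [:c:]"
    by (simp_all add: var_s_def var_t_def real_coeffs_def set_t_def map_poly_pCons)
  then show "lucas_at c (Suc (Suc n)) = [:0, 1:] * lucas_at c (Suc n) + [:c:] * lucas_at c n"
    unfolding lucas_at_def by (simp only: lucas.simps real_coeffs_add real_coeffs_mult set_t_add set_t_mult)
qed (simp_all add: lucas_at_def set_t_def)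

text \<open>At \<open>t = -y\<^sup>2\<close> the Lucas polynomial is a rescaled Chebyshev polynomial of the second kind: its
  recurrence is the one of \<open>sin (n \<theta>)\<close> in \<open>n\<close>. This exhibits its roots \<open>2 y cos (\<pi> k / n)\<close>.\<close>

lemma lucas_at_cos:
  "y * sin \<theta> * poly (lucas_at (- (y\<^sup>2)) n) (2 * y * cos \<theta>) = y ^ n * sin (real n * \<theta>)"
proof (induction n rule: lucas.induct)
  case (3 n)
  have "sin (real n * \<theta>) = sin (real (Suc n) * \<theta> - \<theta>)"
       "sin (real (Suc (Suc n)) * \<theta>) = sin (real (Suc n) * \<theta> + \<theta>)"
    by (simp_all add: algebra_simps)
  then have trig: "sin (real (Suc (Suc n)) * \<theta>) =
      2 * cos \<theta> * sin (real (Suc n) * \<theta>) - sin (real n * \<theta>)"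
    unfolding sin_add sin_diff by simp
  have "y * sin \<theta> * poly (lucas_at (- (y\<^sup>2)) (Suc (Suc n))) (2 * y * cos \<theta>) =
      2 * y * cos \<theta> * (y * sin \<theta> * poly (lucas_at (- (y\<^sup>2)) (Suc n)) (2 * y * cos \<theta>))
      - y\<^sup>2 * (y * sin \<theta> * poly (lucas_at (- (y\<^sup>2)) n) (2 * y * cos \<theta>))"
    by (simp add: lucas_at_simps algebra_simps)
  also have "\<dots> = y ^ Suc (Suc n) * sin (real (Suc (Suc n)) * \<theta>)"
    unfolding 3 trig by (simp add: algebra_simps power2_eq_square)
  finally show ?case .
qed (simp_all add: lucas_at_simps)

text \<open>For \<open>n \<ge> 1\<close> these are the fractions \<open>k / n\<close> with \<open>1 \<le> k \<le> n / 2\<close>. They are kept as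
  real numbers rather than as numerators \<open>k\<close>, so that a factor shared by different Lucas polynomials
  has the same index in each of them.\<close>

definition lucas_angles :: "nat \<Rightarrow> real set" where
  "lucas_angles n = {r. 0 < r \<and> r \<le> 1 / 2 \<and> real n * r \<in> \<int>}"

text \<open>The roots \<open>2 y cos (\<pi> r)\<close> and \<open>2 y cos (\<pi> (1 - r))\<close> at \<open>t = -y\<^sup>2\<close> are opposite, so together they give
  \<open>s\<^sup>2 + 4 cos\<^sup>2 (\<pi> r) t\<close>. At \<open>r = 1/2\<close> they coincide, and the factor is \<open>s\<close> instead of \<open>s\<^sup>2\<close>.\<close>

definition lucas_factor :: "real \<Rightarrow> real poly poly" where
  "lucas_factor r = (if r = 1 / 2 then [:0, 1:] else [:[:0, 4 * (cos (pi * r))\<^sup>2:], 0, 1:])"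

lemma nonneg_lucas_factor: "nonneg_coeffs (lucas_factor r)"
  by (auto simp: nonneg_coeffs_def lucas_factor_def coeff_pCons split: nat.splits)

lemma set_t_lucas_factor:
  "set_t c (lucas_factor r) = (if r = 1 / 2 then [:0, 1:] else [:4 * (cos (pi * r))\<^sup>2 * c, 0, 1:])"
  by (simp add: lucas_factor_def set_t_def map_poly_pCons mult_ac)

lemma lucas_angles_eq:
  assumes "n \<ge> 1"
  shows "lucas_angles n = (\<lambda>k. real k / real n) ` {1..n div 2}"
proof (intro equalityI subsetI)
  fix r
  assume r: "r \<in> lucas_angles n"
  then obtain k :: int where k: "real n * r = of_int k"
    by (auto simp: lucas_angles_def elim: Ints_cases)
  moreover have "real n * r > 0"
    using r assms by (simp add: lucas_angles_def)
  ultimately have "k > 0"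
    by simp
  have "real n * r \<le> real n * (1 / 2)"
    using r by (intro mult_left_mono) (simp_all add: lucas_angles_def)
  then have "2 * k \<le> int n"
    using k by linarith
  then have "nat k \<in> {1..n div 2}"
    using \<open>k > 0\<close> by auto
  moreover have "r = real (nat k) / real n"
    using k \<open>k > 0\<close> assms by (simp add: field_simps)
  ultimately show "r \<in> (\<lambda>k. real k / real n) ` {1..n div 2}"
    by blast
next
  fix r
  assume "r \<in> (\<lambda>k. real k / real n) ` {1..n div 2}"
  then obtain k where k: "1 \<le> k" "k \<le> n div 2" and r: "r = real k / real n"
    by auto
  have "2 * k \<le> n"
    using k by simp
  then have "2 * real k \<le> real n"
    by linarith
  then show "r \<in> lucas_angles n"
    using k assms by (simp add: lucas_angles_def r field_simps)
qed

lemma finite_lucas_angles: "n \<ge> 1 \<Longrightarrow> finite (lucas_angles n)"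
  by (simp add: lucas_angles_eq)

text \<open>Every \<open>k < n / 2\<close> counts twice and \<open>k = n / 2\<close>, which occurs for even \<open>n\<close> only, counts once.\<close>

lemma degree_prod_lucas_factors:
  assumes "n \<ge> 1"
  shows "degree (\<Prod>r\<in>lucas_angles n. set_t c (lucas_factor r)) = n - 1"
proof -
  have "degree (\<Prod>r\<in>lucas_angles n. set_t c (lucas_factor r)) =
      (\<Sum>r\<in>lucas_angles n. if r = 1 / 2 then 1 else 2)"
    by (subst degree_prod_eq_sum_degree) (auto simp: set_t_lucas_factor intro!: sum.cong)
  also have "\<dots> = (\<Sum>k\<in>{1..n div 2}. if 2 * k = n then 1 else 2)"
    unfolding lucas_angles_eq[OF assms] using assms
    by (subst sum.reindex) (auto simp: inj_on_def field_simps intro!: sum.cong)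
  also have "\<dots> = n - 1"
  proof (cases "even n")
    case True
    then obtain m where m: "n = 2 * Suc m"
      using assms by (metis One_nat_def dvdE mult_0_right not0_implies_Suc not_one_le_zero)
    have "(\<Sum>k\<in>{1..m}. if 2 * k = n then 1 else 2) = (\<Sum>k\<in>{1..m}. 2::nat)"
      by (intro sum.cong) (auto simp: m)
    moreover have "{1..n div 2} = insert (Suc m) {1..m}"
      by (auto simp: m)
    ultimately show ?thesis
      by (simp add: m)
  next
    case False
    then have "(\<Sum>k\<in>{1..n div 2}. if 2 * k = n then 1 else 2) = (\<Sum>k\<in>{1..n div 2}. 2::nat)"
      by (intro sum.cong) auto
    then show ?thesis
      using odd_two_times_div_two_nat[OF False] by (simp add: mult.commute)
  qed
  finally show ?thesis .
qed

text \<open>Both sides are monic of degree \<open>n - 1\<close> and vanish at the \<open>n - 1\<close> distinct points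
  \<open>2 y cos (\<pi> k / n)\<close>.\<close>

lemma lucas_at_factorization:
  assumes "n \<ge> 1" "y > 0"
  shows "lucas_at (- (y\<^sup>2)) n = (\<Prod>r\<in>lucas_angles n. set_t (- (y\<^sup>2)) (lucas_factor r))"
    (is "?L = ?P")
proof (rule poly_eqI_degree_lead_coeff)
  let ?A = "(\<lambda>k. 2 * y * cos (pi * (real k / real n))) ` {1..n - 1}"
  show "degree ?L \<le> n - 1"
    unfolding lucas_at_def
    by (rule degree_le) (simp add: coeff_set_t coeff_eq_0 degree_real_coeffs degree_lucas)
  have "coeff (real_coeffs (lucas n)) (n - 1) = 1"
    using lead_coeff_lucas[OF assms(1)] by (simp add: real_coeffs_def coeff_map_poly degree_lucas)
  then have "coeff ?L (n - 1) = 1"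
    by (simp add: lucas_at_def coeff_set_t)
  moreover have "lead_coeff ?P = 1"
    unfolding lead_coeff_prod by (intro prod.neutral) (simp add: set_t_lucas_factor)
  ultimately show "coeff ?L (n - 1) = coeff ?P (n - 1)"
    unfolding degree_prod_lucas_factors[OF assms(1)] by simp
  show "degree ?P \<le> n - 1"
    unfolding degree_prod_lucas_factors[OF assms(1)] by simp
  have angle: "0 < pi * (real k / real n)" "pi * (real k / real n) < pi"
    if "1 \<le> k" "k < n" for k
  proof -
    have "0 < real k / real n" "real k / real n < 1"
      using that by simp_all
    then show "0 < pi * (real k / real n)" "pi * (real k / real n) < pi"
      using mult_pos_pos[of pi "real k / real n"] mult_strict_left_mono[of "real k / real n" 1 pi]
      by (simp_all only: pi_gt_zero mult_1_right)
  qed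
  have "inj_on (\<lambda>k. 2 * y * cos (pi * (real k / real n))) {1..n - 1}"
  proof (rule inj_onI)
    fix j k
    assume jk: "j \<in> {1..n - 1}" "k \<in> {1..n - 1}"
      and "2 * y * cos (pi * (real j / real n)) = 2 * y * cos (pi * (real k / real n))"
    then have eq: "cos (pi * (real j / real n)) = cos (pi * (real k / real n))"
      using assms by simp
    have "1 \<le> j" "j < n" "1 \<le> k" "k < n"
      using jk by auto
    then have "pi * (real j / real n) = pi * (real k / real n)"
      by (intro cos_inj_pi[OF _ _ _ _ eq]) (simp_all only: less_imp_le angle)
    then show "j = k"
      using assms by simp
  qed
  then show "n - 1 \<le> card ?A"
    by (simp add: card_image)
  fix z
  assume "z \<in> ?A"
  then obtain k where k: "1 \<le> k" "k < n" and z: "z = 2 * y * cos (pi * (real k / real n))"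
    by auto
  have "y * sin (pi * (real k / real n)) * poly ?L z = y ^ n * sin (real n * (pi * (real k / real n)))"
    unfolding z by (rule lucas_at_cos)
  also have "real n * (pi * (real k / real n)) = real k * pi"
    using assms by simp
  also have "y ^ n * sin (real k * pi) = 0"
    by simp
  finally have L0: "poly ?L z = 0"
    using assms(2) less_imp_neq[OF sin_gt_zero[OF angle[OF k]]] by (metis less_irrefl mult_eq_0_iff)
  \<comment> \<open>Fold the angle into \<open>(0, 1/2]\<close>; this preserves the square of the cosine.\<close>
  define j where "j = (if 2 * k \<le> n then k else n - k)"
  define r where "r = real j / real n"
  have "1 \<le> j" "j \<le> n div 2"
    using k by (auto simp: j_def)
  then have r: "r \<in> lucas_angles n"
    using assms by (auto simp: lucas_angles_eq r_def)
  have cos2: "(cos (pi * (real k / real n)))\<^sup>2 = (cos (pi * r))\<^sup>2"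
  proof (cases "2 * k \<le> n")
    case False
    then have "pi * r = pi - pi * (real k / real n)"
      using k by (simp add: r_def j_def of_nat_diff field_simps)
    then show ?thesis
      by (simp only: cos_pi_minus power2_minus)
  qed (simp add: r_def j_def)
  have "poly (set_t (- (y\<^sup>2)) (lucas_factor r)) z = 0"
  proof (cases "r = 1 / 2")
    case True
    then have "cos (pi * r) = 0"
      using cos_pi_half by (simp only: mult_1_right times_divide_eq_right)
    then have "z\<^sup>2 = 0"
      unfolding z power_mult_distrib cos2 by simp
    then show ?thesis
      using True by (simp add: set_t_lucas_factor)
  next
    case False
    have "z\<^sup>2 = 4 * y\<^sup>2 * (cos (pi * r))\<^sup>2"
      unfolding z power_mult_distrib cos2 by simp
    then show ?thesis
      using False by (simp add: set_t_lucas_factor power2_eq_square mult_ac)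
  qed
  then have "poly ?P z = 0"
    using r assms finite_lucas_angles by (auto simp: poly_prod prod_zero_iff)
  then show "poly ?L z = poly ?P z"
    using L0 by simp
qed

lemma lucas_factorization:
  assumes "n \<ge> 1"
  shows "real_coeffs (lucas n) = (\<Prod>r\<in>lucas_angles n. lucas_factor r)"
  using assms lucas_at_factorization
  by (intro eq_if_set_t_eq) (simp add: set_t_prod lucas_at_def)

section \<open>Quotients of products of Lucas polynomials\<close>

text \<open>The number \<open>m\<close> is the denominator of \<open>r\<close> in lowest terms; it is at least \<open>2\<close> because
  \<open>0 < r \<le> 1/2\<close>.\<close>

lemma lucas_angles_iff_dvd:
  assumes "r \<in> lucas_angles n" "n \<ge> 1"
  obtains m where "m \<ge> 2" "\<And>d. r \<in> lucas_angles d \<longleftrightarrow> m dvd d"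
proof -
  have r: "0 < r" "r \<le> 1 / 2"
    using assms by (auto simp: lucas_angles_def)
  have "r \<in> \<rat>"
    using assms by (auto simp: lucas_angles_eq)
  then obtain a m :: nat where m: "m \<noteq> 0" "\<bar>r\<bar> = real a / real m" "coprime a m"
    by (rule Rats_abs_nat_div_natE)
  then have req: "r = real a / real m"
    using r by simp
  have "a > 0"
    using r req by (intro gr0I) simp
  moreover have "2 * real a \<le> real m"
    using r m(1) by (simp add: req field_simps)
  ultimately have "m \<ge> 2"
    by linarith
  moreover have "r \<in> lucas_angles d \<longleftrightarrow> m dvd d" for d
  proof -
    have "r \<in> lucas_angles d \<longleftrightarrow> real (d * a) / real m \<in> \<int>"
      using r by (simp add: lucas_angles_def req)
    also have "\<dots> \<longleftrightarrow> m dvd d * a"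
    proof
      assume "real (d * a) / real m \<in> \<int>"
      then obtain k :: int where "real (d * a) / real m = of_int k"
        by (auto elim: Ints_cases)
      then have "real_of_int (int (d * a)) = real_of_int (k * int m)"
        using m(1) by (simp add: field_simps)
      then have "int (d * a) = k * int m"
        by (simp only: of_int_eq_iff)
      then show "m dvd d * a"
        by (metis dvd_triv_right int_dvd_int_iff)
    next
      assume "m dvd d * a"
      then obtain k where "d * a = m * k" ..
      then show "real (d * a) / real m \<in> \<int>"
        using m(1) by simp
    qed
    also have "\<dots> \<longleftrightarrow> m dvd d"
      using m(3) by (simp add: coprime_dvd_mult_left_iff coprime_commute)
    finally show ?thesis .
  qed
  ultimately show ?thesis
    using that by blast
qed

text \<open>A common index set \<open>U\<close> lets numerator and denominator of a quotient be compared factor by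
  factor.\<close>

lemma prod_list_lucas_factorization:
  assumes "finite U" "\<And>d. d \<in> set ds \<Longrightarrow> d \<ge> 1 \<and> lucas_angles d \<subseteq> U"
  shows "real_coeffs (prod_list (map lucas ds)) =
    (\<Prod>r\<in>U. lucas_factor r ^ length (filter (\<lambda>d. r \<in> lucas_angles d) ds))"
  using assms(2)
proof (induction ds)
  case (Cons d ds)
  have "(\<Prod>r\<in>lucas_angles d. lucas_factor r) =
      (\<Prod>r\<in>U. if r \<in> lucas_angles d then lucas_factor r else 1)"
    using Cons.prems[of d] assms(1) by (simp add: inf.absorb2 flip: prod.inter_restrict)
  then show ?case
    using Cons
    by (auto simp: real_coeffs_mult lucas_factorization simp flip: prod.distrib intro!: prod.cong)
qed simp

text \<open>By the second hypothesis every real factor is at least as frequent in the numerator as in the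
  denominator. The quotient is the product \<open>G\<close> of the surplus factors.\<close>

theorem lucas_quotient_nat_polys:
  assumes pos: "\<And>d. d \<in> set ds \<union> set es \<Longrightarrow> d \<ge> 1"
    and le: "\<And>m. m \<ge> 2 \<Longrightarrow> length (filter ((dvd) m) ds) \<le> length (filter ((dvd) m) es)"
  obtains Q where "Q \<in> nat_polys" "prod_list (map lucas es) = prod_list (map lucas ds) * Q"
proof -
  define U where "U = (\<Union>d\<in>set ds \<union> set es. lucas_angles d)"
  define mult where "mult r xs = length (filter (\<lambda>d. r \<in> lucas_angles d) xs)" for r xs
  have U: "finite U"
    using pos finite_lucas_angles by (auto simp: U_def)
  have mult_le: "mult r ds \<le> mult r es" if "r \<in> U" for r
  proof -
    obtain n where "r \<in> lucas_angles n" "n \<ge> 1"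
      using \<open>r \<in> U\<close> pos by (auto simp: U_def)
    then obtain m where "m \<ge> 2" "\<And>d. r \<in> lucas_angles d \<longleftrightarrow> m dvd d"
      by (rule lucas_angles_iff_dvd) blast
    then show ?thesis
      using le[of m] by (simp add: mult_def)
  qed
  define G where "G = (\<Prod>r\<in>U. lucas_factor r ^ (mult r es - mult r ds))"
  have "real_coeffs (prod_list (map lucas es)) = (\<Prod>r\<in>U. lucas_factor r ^ mult r es)"
    unfolding mult_def using pos U
    by (intro prod_list_lucas_factorization) (auto simp: U_def)
  also have "\<dots> = (\<Prod>r\<in>U. lucas_factor r ^ mult r ds) * G"
    unfolding G_def prod.distrib[symmetric]
    using mult_le by (intro prod.cong) (simp_all flip: power_add)
  also have "(\<Prod>r\<in>U. lucas_factor r ^ mult r ds) = real_coeffs (prod_list (map lucas ds))"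
    unfolding mult_def using pos U
    by (intro prod_list_lucas_factorization[symmetric]) (auto simp: U_def)
  finally have eq: "real_coeffs (prod_list (map lucas es)) = real_coeffs (prod_list (map lucas ds)) * G" .
  have "lead_coeff (prod_list (map lucas ds)) = 1"
    using pos by (induction ds) (auto simp: lead_coeff_mult lead_coeff_lucas)
  then obtain Q where Q: "prod_list (map lucas es) = prod_list (map lucas ds) * Q" "real_coeffs Q = G"
    using real_quotient_is_integral[OF _ eq] by blast
  have "nonneg_coeffs G"
    unfolding G_def by (intro nonneg_coeffs_prod nonneg_coeffs_power nonneg_lucas_factor)
  then have "coeff (coeff Q i) j \<ge> 0" for i j
    using coeff_real_coeffs[of Q i j] Q(2) unfolding nonneg_coeffs_def by (metis of_int_0_le_iff)
  then have "Q \<in> nat_polys"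
    unfolding nat_polys_def by (auto simp: Nats_altdef2 Ints_def)
  then show ?thesis
    using Q that by blast
qed

section \<open>Divisibility among the degrees\<close>

lemma count_multiples:
  assumes "m > 0"
  shows "length (filter (\<lambda>i. m dvd a + i) [1..<n + 1]) = (a + n) div m - a div m"
proof (induction n)
  case (Suc n)
  have "a div m \<le> (a + n) div m"
    by (simp add: div_le_mono)
  then show ?case
    using Suc assms by (auto simp: div_Suc dvd_eq_mod_eq_0 Suc_diff_le)
qed simp

lemma count_multiples_0:
  assumes "m > (0::nat)"
  shows "length (filter (\<lambda>i. m dvd i) [1..<n + 1]) = n div m"
  using count_multiples[OF assms, of 0 n] by simp

lemma div_add_div_le: "a div m + b div m \<le> (a + b) div (m::nat)"
  by (metis add.commute div_add1_eq le_add1)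

text \<open>Passing from \<open>m\<close> to \<open>m / gcd m 2\<close> reduces the even degrees of types \<open>B\<close> and \<open>D\<close> to intervals of
  integers.\<close>

lemma dvd_double_iff:
  fixes m :: nat
  assumes "m \<ge> 2"
  obtains k where "k \<ge> 1" "k = (if even m then m div 2 else m)" "\<And>i. m dvd 2 * i \<longleftrightarrow> k dvd i"
proof (cases "even m")
  case True
  then show ?thesis
    using assms that[of "m div 2"] by (auto elim!: evenE)
next
  case False
  then show ?thesis
    using assms that[of m] by (auto simp: coprime_dvd_mult_right_iff)
qed

text \<open>If \<open>k\<close> divides \<open>N + 1\<close>, then doubling \<open>N = k (p + 1) - 1\<close> doubles its remainder \<open>k - 1\<close>, which
  produces a carry. In type \<open>A\<close> this makes up for a multiple \<open>n + 2\<close> of \<open>m\<close>, which lies in the gap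
  between the degrees \<open>2, \<dots>, n + 1\<close> and the indices \<open>n + 3, \<dots>, 2 n + 2\<close> of the numerator; in type
  \<open>D\<close> it makes up for the degree \<open>n\<close>.\<close>

lemma double_div_pred_multiple:
  fixes k N :: nat
  assumes "k \<ge> 2" "k dvd N + 1"
  shows "(2 * N) div k = 2 * (N div k) + 1"
proof -
  obtain q where "N + 1 = k * q"
    using assms(2) ..
  then obtain p where p: "N + 1 = k * Suc p"
    by (cases q) auto
  have N: "N = k * p + (k - 1)" and N2: "2 * N = k * (2 * p + 1) + (k - 2)"
    using p assms by (simp_all add: algebra_simps)
  have "N div k = p"
    unfolding N using assms by (subst div_mult_self4) simp_all
  moreover have "(2 * N) div k = 2 * p + 1"
    unfolding N2 using assms by (subst div_mult_self4) simp_all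
  ultimately show ?thesis
    by simp
qed

lemma degree_multiples_le_A:
  assumes "m \<ge> (2::nat)"
  shows "length (filter ((dvd) m) (degrees (Cox_A n))) \<le>
    length (filter (\<lambda>d. m dvd (n + 1) + d) (degrees (Cox_A n)))"
proof -
  have 1: "length (filter ((dvd) m) (degrees (Cox_A n))) = (n + 1) div m"
    using count_multiples[of m 1 n] assms by (simp add: filter_map comp_def)
  have 2: "length (filter (\<lambda>d. m dvd (n + 1) + d) (degrees (Cox_A n))) =
      (2 * n + 2) div m - (n + 2) div m"
    using count_multiples[of m "n + 2" n] assms by (simp add: filter_map comp_def mult_2)
  have "(n + 1) div m + (n + 2) div m \<le> (2 * n + 2) div m"
  proof (cases "m dvd n + 2")
    case True
    then show ?thesis
      using double_div_pred_multiple[of m "n + 1"] assms div_Suc[of "n + 1" m]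
      by (simp add: dvd_eq_mod_eq_0)
  next
    case False
    then have "(n + 2) div m = (n + 1) div m"
      using div_Suc[of "n + 1" m] by (simp add: dvd_eq_mod_eq_0)
    then show ?thesis
      using div_add_div_le[of "n + 1" m "n + 1"] by (simp add: mult_2)
  qed
  then show ?thesis
    unfolding 1 2 by linarith
qed

lemma degree_multiples_le_B:
  assumes "m \<ge> (2::nat)"
  shows "length (filter ((dvd) m) (map (\<lambda>i. 2 * i) [1..<n + 1])) \<le>
    length (filter (\<lambda>d. m dvd 2 * n + d) (map (\<lambda>i. 2 * i) [1..<n + 1]))"
proof -
  obtain k where k: "k \<ge> 1" "\<And>i. m dvd 2 * i \<longleftrightarrow> k dvd i"
    using dvd_double_iff[OF assms] by metis
  have k_shift: "m dvd 2 * n + 2 * i \<longleftrightarrow> k dvd n + i" for i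
    using k(2)[of "n + i"] by (simp add: distrib_left)
  have "length (filter ((dvd) m) (map (\<lambda>i. 2 * i) [1..<n + 1])) = n div k"
    unfolding filter_map length_map comp_def k(2) using k(1) by (intro count_multiples_0) simp
  moreover have "length (filter (\<lambda>d. m dvd 2 * n + d) (map (\<lambda>i. 2 * i) [1..<n + 1])) =
      (n + n) div k - n div k"
    unfolding filter_map length_map comp_def k_shift using k(1) by (intro count_multiples) simp
  moreover have "n div k + n div k \<le> (n + n) div k"
    by (rule div_add_div_le)
  ultimately show ?thesis by linarith
qed

text \<open>Compared with type \<open>B\<close> there is the additional degree \<open>n\<close>. If \<open>m\<close> divides it, then \<open>m = 2\<close> also
  divides the additional numerator index \<open>3 n - 2\<close>, and for \<open>m \<ge> 3\<close> the even degrees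
  supply a surplus of one.\<close>

lemma degree_multiples_le_D:
  assumes "m \<ge> (2::nat)" "n \<ge> 1"
  shows "length (filter ((dvd) m) (degrees (Cox_D n))) \<le>
    length (filter (\<lambda>d. m dvd 2 * (n - 1) + d) (degrees (Cox_D n)))"
proof -
  obtain N where n: "n = N + 1"
    using assms(2) by (metis add.commute le_Suc_ex)
  obtain k where k: "k \<ge> 1" "k = (if even m then m div 2 else m)" "\<And>i. m dvd 2 * i \<longleftrightarrow> k dvd i"
    using dvd_double_iff[OF assms(1)] by metis
  have degrees: "degrees (Cox_D n) = map ((*) 2) [1..<N + 1] @ [N + 1]"
    by (simp add: n)
  have k_shift: "m dvd 2 * N + 2 * i \<longleftrightarrow> k dvd N + i" for i
    using k(3)[of "N + i"] by (simp add: distrib_left)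
  \<comment> \<open>The index \<open>h + n\<close> of the last degree.\<close>
  have top: "2 * N + (N + 1) = 3 * N + 1"
    by simp
  have count_d: "length (filter ((dvd) m) (degrees (Cox_D n))) =
      N div k + (if m dvd N + 1 then 1 else 0)"
    unfolding degrees filter_append filter_map length_append length_map comp_def k(3)
    by (subst count_multiples_0) (use k(1) in auto)
  have count_hd: "length (filter (\<lambda>d. m dvd 2 * (n - 1) + d) (degrees (Cox_D n))) =
      ((N + N) div k - N div k) + (if m dvd 3 * N + 1 then 1 else 0)"
    unfolding degrees unfolding n filter_append filter_map length_append length_map comp_def
      add_diff_cancel_right' k_shift
    by (subst count_multiples) (use k(1) top in auto)
  have le: "N div k + N div k \<le> (N + N) div k"
    by (rule div_add_div_le)
  consider "\<not> m dvd N + 1" | "m dvd N + 1" "m = 2" | "m dvd N + 1" "m \<ge> 3"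
    using assms(1) by linarith
  then show ?thesis
  proof cases
    case 1
    then show ?thesis
      unfolding count_d count_hd using le by simp
  next
    case 2
    then have "m dvd 3 * N + 1"
      by simp
    then show ?thesis
      unfolding count_d count_hd using le 2 by simp
  next
    case 3
    have "k \<ge> 2"
      using 3 k(2) by (auto elim!: evenE)
    moreover have "k dvd N + 1"
      using 3(1) k(3)[of "N + 1"] dvd_mult by blast
    ultimately have "(N + N) div k = 2 * (N div k) + 1"
      using double_div_pred_multiple[of k N] by (simp add: mult_2)
    then show ?thesis
      unfolding count_d count_hd by simp
  qed
qed

lemma degree_multiples_le_I2:
  assumes "p \<ge> (2::nat)"
  shows "length (filter ((dvd) p) [2, m]) \<le> length (filter (\<lambda>d. p dvd m + d) [2, m])"
proof (cases "p dvd 2")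
  case True
  then have "p = 2"
    using assms by (metis dvd_imp_le order_antisym zero_less_numeral)
  then show ?thesis by simp
qed auto

text \<open>No degree of these types exceeds \<open>30\<close>, so larger \<open>m\<close> divide none of them.\<close>

lemma degree_multiples_le_exceptional:
  assumes "W \<in> {Cox_H3, Cox_H4, Cox_F4, Cox_E6, Cox_E7, Cox_E8}"
  shows "length (filter ((dvd) m) (degrees W)) \<le>
    length (filter (\<lambda>d. m dvd coxeter_number W + d) (degrees W))"
proof (cases "m \<le> 30")
  case True
  have "\<forall>m\<in>set [0..<31]. \<forall>W\<in>set [Cox_H3, Cox_H4, Cox_F4, Cox_E6, Cox_E7, Cox_E8].
      length (filter ((dvd) m) (degrees W)) \<le>
      length (filter (\<lambda>d. m dvd coxeter_number W + d) (degrees W))"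
    by code_simp
  moreover have "m \<in> set [0..<31]" "W \<in> set [Cox_H3, Cox_H4, Cox_F4, Cox_E6, Cox_E7, Cox_E8]"
    using True assms by auto
  ultimately show ?thesis
    by blast
next
  case False
  have "\<forall>d\<in>set (degrees W). 0 < d \<and> d \<le> 30"
    using assms by auto
  then have "filter ((dvd) m) (degrees W) = []"
    using False unfolding filter_empty_conv by (meson dvd_imp_le le_trans)
  then show ?thesis by simp
qed

lemma degree_multiples_le:
  assumes "coxeter_type W" "m \<ge> 2"
  shows "length (filter ((dvd) m) (degrees W)) \<le>
    length (filter (\<lambda>d. m dvd coxeter_number W + d) (degrees W))"
proof (cases W)
  case (Cox_A n)
  then show ?thesis
    using degree_multiples_le_A[OF assms(2)] by simp
next
  case (Cox_B n)
  then show ?thesis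
    using degree_multiples_le_B[OF assms(2)] by simp
next
  case (Cox_D n)
  then show ?thesis
    using degree_multiples_le_D[OF assms(2), of n] assms(1) by simp
next
  case (Cox_I2 n)
  then show ?thesis
    using degree_multiples_le_I2[OF assms(2), of n] by simp
qed (rule degree_multiples_le_exceptional; simp)+

section \<open>The Catalan numbers of Coxeter groups\<close>

lemma prod_divide_nth:
  fixes f g :: "'a \<Rightarrow> 'b::field"
  shows "(\<Prod>i<length xs. f (xs ! i) / g (xs ! i)) = prod_list (map f xs) / prod_list (map g xs)"
  by (induction xs) (simp_all add: prod.lessThan_Suc_shift del: prod.lessThan_Suc)

lemma to_fract_prod_list:
  fixes xs :: "'a::idom list"
  shows "to_fract (prod_list xs) = prod_list (map to_fract xs)"
  by (induction xs) simp_all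

lemma to_fract_quotient:
  fixes A B Q :: "'a::idom"
  assumes "A = B * Q" "B \<noteq> 0"
  shows "to_fract A / to_fract B = to_fract Q"
  using assms by simp

lemma coxeter_cat_eq_quotient:
  "coxeter_cat W =
    to_fract (prod_list (map lucas (map ((+) (coxeter_number W)) (degrees W)))) /
    to_fract (prod_list (map lucas (degrees W)))"
  unfolding coxeter_cat_def to_fract_prod_list map_map comp_def
  by (rule prod_divide_nth[where f = "\<lambda>d. to_fract (lucas (coxeter_number W + d))"
        and g = "\<lambda>d. to_fract (lucas d)"])

theorem theorem5p6:
  fixes W :: coxeter
  assumes "coxeter_type W"
  shows "coxeter_cat W \<in> to_fract ` nat_polys"
proof -
  let ?ds = "degrees W" and ?es = "map ((+) (coxeter_number W)) (degrees W)"
  have pos: "d \<ge> 1" if "d \<in> set ?ds \<union> set ?es" for d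
    using that degrees_pos[OF assms] by (auto intro: trans_le_add2)
  have "length (filter ((dvd) m) ?ds) \<le> length (filter ((dvd) m) ?es)" if "m \<ge> 2" for m
    using degree_multiples_le[OF assms that] by (simp add: filter_map comp_def)
  then obtain Q where Q: "Q \<in> nat_polys" "prod_list (map lucas ?es) = prod_list (map lucas ?ds) * Q"
    using lucas_quotient_nat_polys[of ?ds ?es] pos by metis
  have "lucas d \<noteq> 0" if "d \<in> set ?ds" for d
    by (rule lucas_nonzero[OF degrees_pos[OF assms that]])
  then have "0 \<notin> set (map lucas ?ds)"
    by (metis imageE list.set_map)
  then have "prod_list (map lucas ?ds) \<noteq> 0"
    unfolding prod_list_zero_iff .
  with Q(2) have "coxeter_cat W = to_fract Q"
    unfolding coxeter_cat_eq_quotient by (rule to_fract_quotient)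
  then show ?thesis
    using Q(1) by (rule image_eqI)
qed

end
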